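(* For every integer $n\ge 1$, $$(-1)^{n-1}\sum_{G} (-1)^{e(G)}=(n-1)!,$$ where the sum is over all connected graphs $G$ with vertex set $\{1,\ldots,n\}$ (equivalently, all connected spanning subgraphs of the complete graph $K_n$), and $e(G)$ is the number of edges of $G$.
   Context: Graphs are simple, undirected and labelled: the sum runs over labelled graphs on the fixed vertex set $\{1,\ldots,n\}$ (not isomorphism classes). *)

theory Defs
  imports Graph_Theory.Graph_Theory
begin

text \<open>
  In the library, a finite simple undirected graph is a \<^locale>\<open>pair_graph\<close>: a finite loop-free digraph
  without parallel arcs whose arc set is symmetric. An undirected edge \<open>{u, v}\<close> is thus represented
  by the two arcs \<open>(u, v)\<close> and \<open>(v, u)\<close>, so edges must be counted as two-element sets, not as arcs.
\<close>

definition undirected_edges :: "'a pair_pre_digraph \<Rightarrow> 'a set set" where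
  "undirected_edges G = {{u, v} | u v. (u, v) \<in> parcs G}"

text \<open>
  The library's predicate is written with its qualified name, because \<open>connected\<close> is also the name
  of the topological notion. Its definition requires a nonempty vertex set.
\<close>

definition connected_labelled_graphs :: "nat \<Rightarrow> nat pair_pre_digraph set" where
  "connected_labelled_graphs n =
    {G. pair_graph G \<and> pverts G = {1..n} \<and> Digraph_Component.connected (with_proj G)}"

end

theory Submission
  imports Defs
begin

text \<open>
  Toggling an edge \<open>e\<close> changes the sign \<open>(-1) ^ e(G)\<close>, so any family of graphs closed under this
  toggle has signed sum \<open>0\<close>. Fix a root \<open>v\<close>. All graphs on a vertex set \<open>V\<close> with at least two
  elements have signed sum \<open>0\<close>. Split them by the component \<open>S\<close> of \<open>v\<close>: if \<open>V - S\<close> has at least two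
  elements, toggling an edge inside \<open>V - S\<close> shows that the part of \<open>S\<close> vanishes. Only \<open>S = V\<close> and
  \<open>S = V - {u}\<close> with \<open>u \<noteq> v\<close> remain, so the signed sums \<open>c\<^sub>n\<close> over connected graphs satisfy
  \<open>c\<^sub>n = - (n - 1) c\<^bsub>n-1\<^esub>\<close>.
\<close>

section \<open>Edge sets, components and edge toggling\<close>

definition adjacency :: "'a set set \<Rightarrow> 'a rel" where
  "adjacency E = {(x, y). {x, y} \<in> E}"

definition component :: "'a \<Rightarrow> 'a set set \<Rightarrow> 'a set" where
  "component v E = (adjacency E)\<^sup>* `` {v}"

definition complete_edges :: "'a set \<Rightarrow> 'a set set" where
  "complete_edges V = {e. e \<subseteq> V \<and> card e = 2}"

definition toggle :: "'a \<Rightarrow> 'a set \<Rightarrow> 'a set" where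
  "toggle e E = (if e \<in> E then E - {e} else insert e E)"

lemma root_in_component: "v \<in> component v E"
  by (simp add: component_def)

lemma component_closed:
  assumes "x \<in> component v E" "{x, y} \<in> E"
  shows "y \<in> component v E"
  using assms unfolding component_def adjacency_def
  by (auto intro: rtrancl_into_rtrancl)

lemma component_subsetI:
  assumes "v \<in> S" and closed: "\<And>x y. x \<in> S \<Longrightarrow> {x, y} \<in> E \<Longrightarrow> y \<in> S"
  shows "component v E \<subseteq> S"
proof
  fix w assume "w \<in> component v E"
  then have "(v, w) \<in> (adjacency E)\<^sup>*" by (simp add: component_def)
  then show "w \<in> S"
    by induct (use assms in \<open>auto simp: adjacency_def\<close>)
qed

lemma finite_complete_edges: "finite V \<Longrightarrow> finite (complete_edges V)"
  unfolding complete_edges_def by (rule finite_subset[of _ "Pow V"]) auto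

lemma component_subset_vertices:
  assumes "v \<in> V" "E \<subseteq> complete_edges V"
  shows "component v E \<subseteq> V"
  by (rule component_subsetI) (use assms in \<open>auto simp: complete_edges_def\<close>)

lemma toggle_toggle: "toggle e (toggle e E) = E"
  by (auto simp: toggle_def)

lemma toggle_subset: "e \<in> K \<Longrightarrow> E \<subseteq> K \<Longrightarrow> toggle e E \<subseteq> K"
  by (auto simp: toggle_def)

text \<open>Walks from \<open>v\<close> never leave its component, so they cannot meet an edge
  disjoint from it; adding or deleting such an edge changes nothing that \<open>v\<close> can
  reach.\<close>

lemma component_toggle:
  assumes disj: "e \<inter> component v E = {}"
  shows "component v (toggle e E) = component v E"
proof
  show sub: "component v (toggle e E) \<subseteq> component v E"
  proof (rule component_subsetI[OF root_in_component])
    fix x y assume x: "x \<in> component v E" and "{x, y} \<in> toggle e E"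
    then have "{x, y} \<in> E"
      using disj by (auto simp: toggle_def split: if_splits)
    then show "y \<in> component v E" using component_closed x by metis
  qed
  show "component v E \<subseteq> component v (toggle e E)"
  proof (rule component_subsetI[OF root_in_component])
    fix x y assume x: "x \<in> component v (toggle e E)" and "{x, y} \<in> E"
    \<comment> \<open>Disjointness is known only for the component before toggling;
      \<open>sub\<close> places \<open>x\<close> there, so \<open>{x, y}\<close> is not
      \<open>e\<close>.\<close>
    then have "{x, y} \<in> toggle e E"
      using disj sub by (auto simp: toggle_def)
    then show "y \<in> component v (toggle e E)" using component_closed x by metis
  qed
qed

lemma sign_toggle:
  assumes "finite E"
  shows "(- 1 :: int) ^ card (toggle e E) = - ((- 1) ^ card E)"
proof (cases "e \<in> E")
  case True
  have "card E = Suc (card (E - {e}))" using assms True by (rule card.remove)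
  then have "(- 1 :: int) ^ card E = - ((- 1) ^ card (E - {e}))" by (simp only: power_Suc mult_minus1)
  then show ?thesis using True by (simp only: toggle_def if_True minus_minus)
next
  case False
  then show ?thesis using assms by (simp add: toggle_def)
qed

text \<open>\<open>toggle e\<close> is a sign-reversing involution of \<open>F\<close>, so
  reindexing along it shows that the sum equals its own negative.\<close>

lemma signed_sum_toggle_closed:
  assumes "\<And>E. E \<in> F \<Longrightarrow> finite E" and closed: "\<And>E. E \<in> F \<Longrightarrow> toggle e E \<in> F"
  shows "(\<Sum>E\<in>F. (- 1 :: int) ^ card E) = 0"
proof -
  have "(\<Sum>E\<in>F. (- 1 :: int) ^ card E) = (\<Sum>E\<in>F. - ((- 1 :: int) ^ card E))"
    by (rule sum.reindex_bij_witness[where i = "toggle e" and j = "toggle e"])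
       (use assms in \<open>auto simp: toggle_toggle sign_toggle\<close>)
  then show ?thesis by (simp add: sum_negf)
qed

lemma obtain_edge:
  assumes "card V \<ge> 2"
  obtains e where "e \<in> complete_edges V"
  using obtain_subset_with_card_n[OF assms] by (auto simp: complete_edges_def)

section \<open>The recursion for signed sums over connected edge sets\<close>

lemma signed_sum_component_eq_zero:
  assumes "finite V" "card (V - S) \<ge> 2"
  shows "(\<Sum>E | E \<subseteq> complete_edges V \<and> component v E = S. (- 1 :: int) ^ card E) = 0"
proof -
  obtain e where e: "e \<in> complete_edges (V - S)"
    using obtain_edge[OF assms(2)] by blast
  show ?thesis
  proof (rule signed_sum_toggle_closed[where e = e])
    fix E assume E: "E \<in> {E. E \<subseteq> complete_edges V \<and> component v E = S}"
    then show "finite E"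
      using finite_complete_edges[OF assms(1)] finite_subset by blast
    have "component v (toggle e E) = component v E"
      by (rule component_toggle) (use e E in \<open>auto simp: complete_edges_def\<close>)
    moreover have "e \<in> complete_edges V" using e by (auto simp: complete_edges_def)
    ultimately show "toggle e E \<in> {E. E \<subseteq> complete_edges V \<and> component v E = S}"
      using E toggle_subset[of e "complete_edges V" E] by simp
  qed
qed

text \<open>An edge at \<open>u\<close> would have its other end in the component and pull
  \<open>u\<close> into it. So \<open>u\<close> is isolated, and what remains is a connected graph
  on \<open>V - {u}\<close>, ready for the induction hypothesis.\<close>

lemma component_all_but_one:
  assumes "u \<in> V" "u \<noteq> v"
  shows "E \<subseteq> complete_edges V \<and> component v E = V - {u} \<longleftrightarrow>
    E \<subseteq> complete_edges (V - {u}) \<and> component v E = V - {u}"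
proof -
  have "u \<notin> e" if "E \<subseteq> complete_edges V" "component v E = V - {u}" "e \<in> E" for e
  proof
    assume "u \<in> e"
    have e: "e \<subseteq> V" "card e = 2" using that by (auto simp: complete_edges_def)
    then obtain a b where "e = {a, b}" "a \<noteq> b" by (auto simp: card_2_iff)
    with \<open>u \<in> e\<close> e obtain x where x: "e = {x, u}" "x \<in> V - {u}" by auto
    then have "u \<in> component v E" using component_closed[of x v E u] that by simp
    then show False using that by simp
  qed
  then show ?thesis by (fastforce simp: complete_edges_def)
qed

text \<open>The vertex set is arbitrary because the induction deletes vertices other than the fixed
  root \<open>v\<close>.\<close>

theorem signed_sum_connected:
  assumes "finite V" "v \<in> V" "card V = Suc m"
  shows "(\<Sum>E | E \<subseteq> complete_edges V \<and> component v E = V. (- 1 :: int) ^ card E) = (- 1) ^ m * fact m"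
  using assms
proof (induction m arbitrary: V)
  case 0
  then have V: "V = {v}" by (auto simp: card_Suc_eq)
  have "e \<notin> complete_edges {v}" for e
    using card_mono[of "{v}" e] by (auto simp: complete_edges_def)
  then have "complete_edges V = {}" using V by auto
  moreover have "component v {} = {v}" by (simp add: component_def adjacency_def)
  ultimately have "{E. E \<subseteq> complete_edges V \<and> component v E = V} = {{}}" using V by auto
  then show ?case by simp
next
  case (Suc m)
  define A where "A = Pow (complete_edges V)"
  define c where "c S = (\<Sum>E | E \<subseteq> complete_edges V \<and> component v E = S. (- 1 :: int) ^ card E)" for S
  have fin: "finite (complete_edges V)" "finite A"
    using finite_complete_edges Suc.prems by (auto simp: A_def)
  obtain e where e: "e \<in> complete_edges V" using obtain_edge[of V] Suc.prems by auto
  then have "0 = (\<Sum>E\<in>A. (- 1 :: int) ^ card E)"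
    by (intro signed_sum_toggle_closed[symmetric, where e = e])
       (use fin toggle_subset[OF e] in \<open>simp_all add: A_def finite_subset\<close>)
  \<comment> \<open>All edge sets are grouped by the component of \<open>v\<close>.\<close>
  also have "\<dots> = (\<Sum>S\<in>Pow V. c S)"
  proof -
    have "component v ` A \<subseteq> Pow V"
      using component_subset_vertices[OF Suc.prems(2)] by (auto simp: A_def)
    moreover have "{E \<in> A. component v E = S} = {E. E \<subseteq> complete_edges V \<and> component v E = S}" for S
      by (auto simp: A_def)
    ultimately show ?thesis
      using sum.group[of A "Pow V" "component v" "\<lambda>E. (- 1 :: int) ^ card E"] fin Suc.prems(1)
      by (simp add: c_def)
  qed
  \<comment> \<open>A nonzero term needs \<open>v\<close> in \<open>S\<close> and at most one vertex
    outside \<open>S\<close>.\<close>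
  also have "\<dots> = (\<Sum>S\<in>insert V ((\<lambda>u. V - {u}) ` (V - {v})). c S)"
  proof (rule sum.mono_neutral_right)
    show "\<forall>S\<in>Pow V - insert V ((\<lambda>u. V - {u}) ` (V - {v})). c S = 0"
    proof
      fix S assume S: "S \<in> Pow V - insert V ((\<lambda>u. V - {u}) ` (V - {v}))"
      show "c S = 0"
      proof (cases "v \<in> S")
        case False
        then have "component v E \<noteq> S" for E using root_in_component by metis
        then show ?thesis by (simp add: c_def)
      next
        case True
        have "card (V - S) \<noteq> 0" using S Suc.prems by auto
        moreover have "card (V - S) \<noteq> 1"
        proof
          assume "card (V - S) = 1"
          then obtain u where "V - S = {u}" by (auto simp: card_1_singleton_iff)
          then have "S = V - {u}" "u \<in> V - {v}" using S True by auto
          then show False using S by blast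
        qed
        ultimately have "card (V - S) \<ge> 2" by linarith
        then show ?thesis
          unfolding c_def using Suc.prems(1) by (rule signed_sum_component_eq_zero[rotated])
      qed
    qed
  qed (use Suc.prems in auto)
  also have "\<dots> = c V + (\<Sum>S\<in>(\<lambda>u. V - {u}) ` (V - {v}). c S)"
    using Suc.prems by (intro sum.insert) auto
  also have "(\<Sum>S\<in>(\<lambda>u. V - {u}) ` (V - {v}). c S) = (\<Sum>u\<in>V - {v}. c (V - {u}))"
    by (rule sum.reindex_cong[of "\<lambda>u. V - {u}"]) (auto simp: inj_on_def)
  also have "\<dots> = (\<Sum>u\<in>V - {v}. (- 1) ^ m * fact m)"
  proof (rule sum.cong[OF refl])
    fix u assume u: "u \<in> V - {v}"
    then have "c (V - {u}) =
        (\<Sum>E | E \<subseteq> complete_edges (V - {u}) \<and> component v E = V - {u}. (- 1 :: int) ^ card E)"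
      unfolding c_def using component_all_but_one[of u V v] by simp
    also have "\<dots> = (- 1) ^ m * fact m"
      using u Suc.prems by (intro Suc.IH) auto
    finally show "c (V - {u}) = (- 1) ^ m * fact m" .
  qed
  \<comment> \<open>Here \<open>V\<close> has \<open>m + 2\<close> elements, which leaves
    \<open>m + 1\<close> choices of \<open>u\<close>.\<close>
  also have "\<dots> = int (Suc m) * ((- 1) ^ m * fact m)"
    using Suc.prems by simp
  finally have "c V = (- 1) ^ Suc m * fact (Suc m)"
    by (simp add: algebra_simps)
  then show ?case by (simp add: c_def)
qed

section \<open>Transfer between library graphs and edge sets\<close>

lemma parcs_eq_adjacency:
  assumes "pair_graph G"
  shows "parcs G = adjacency (undirected_edges G)"
proof -
  interpret pair_graph G by fact
  have "(y, x) \<in> parcs G" if "(x, y) \<in> parcs G" for x y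
    using that pair_sym_arcs by (auto simp: symmetric_def sym_def)
  then show ?thesis
    by (auto simp: adjacency_def undirected_edges_def doubleton_eq_iff)
qed

lemma undirected_edges_subset_complete_edges:
  assumes "pair_graph G"
  shows "undirected_edges G \<subseteq> complete_edges (pverts G)"
proof -
  interpret pair_graph G by fact
  show ?thesis
    using no_loops' in_arcsD1 in_arcsD2
    by (fastforce simp: undirected_edges_def complete_edges_def card_2_iff)
qed

lemma pair_graph_adjacency:
  assumes "finite V" "E \<subseteq> complete_edges V"
  shows "pair_graph \<lparr>pverts = V, parcs = adjacency E\<rparr>"
proof -
  have *: "x \<in> V \<and> y \<in> V \<and> x \<noteq> y" if "(x, y) \<in> adjacency E" for x y
    using that assms(2) by (auto simp: adjacency_def complete_edges_def card_insert_if split: if_splits)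
  then have "adjacency E \<subseteq> V \<times> V" by auto
  then have "finite (adjacency E)" using assms(1) finite_subset by blast
  moreover have "sym (adjacency E)" by (auto simp: sym_def adjacency_def insert_commute)
  ultimately show ?thesis
    using * assms(1) by unfold_locales (auto simp: symmetric_def)
qed

text \<open>With \<open>parcs_eq_adjacency\<close> this makes graphs on \<open>V\<close> and subsets
  of \<open>complete_edges V\<close> correspond bijectively. Members of \<open>E\<close> not of the
  form \<open>{x, y}\<close> would be lost in \<open>adjacency E\<close>.\<close>

lemma undirected_edges_adjacency:
  assumes "E \<subseteq> complete_edges V"
  shows "undirected_edges \<lparr>pverts = V, parcs = adjacency E\<rparr> = E"
proof -
  have "\<exists>x y. e = {x, y}" if "e \<in> E" for e
  proof -
    have "card e = 2" using that assms by (auto simp: complete_edges_def)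
    then show ?thesis by (auto simp: card_2_iff)
  qed
  then show ?thesis
    by (fastforce simp: undirected_edges_def adjacency_def)
qed

text \<open>The library asks for reachability between all pairs of vertices; as arcs are symmetric,
  any two vertices are joined through the root, so reachability from \<open>v\<close>
  suffices.\<close>

lemma connected_iff_component:
  assumes G: "pair_graph G" and v: "v \<in> pverts G"
  shows "Digraph_Component.connected (with_proj G) \<longleftrightarrow> component v (undirected_edges G) = pverts G"
proof -
  interpret pair_graph G by fact
  let ?E = "undirected_edges G"
  have reach: "x \<rightarrow>\<^sup>*\<^bsub>mk_symmetric G\<^esub> y \<longleftrightarrow> (x, y) \<in> (adjacency ?E)\<^sup>*" if "x \<in> pverts G" for x y
  proof -
    \<comment> \<open>Library reachability is a closure confined to the vertex set; arcs end in
      vertices, so a walk starting at a vertex satisfies this automatically.\<close>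
    have "(x, y) \<in> rtrancl_on (pverts G) (parcs G)" if "(x, y) \<in> (parcs G)\<^sup>*"
      using that
    proof induct
      case (step y z)
      then show ?case using in_arcsD2 by (blast intro: rtrancl_on_into_rtrancl_on)
    qed (use \<open>x \<in> pverts G\<close> in simp)
    then have "x \<rightarrow>\<^sup>*\<^bsub>G\<^esub> y \<longleftrightarrow> (x, y) \<in> (parcs G)\<^sup>*"
      unfolding reachable_def by (auto intro: rtrancl_on_rtranclI)
    then show ?thesis
      using reachable_mk_symmetric_eq[OF sym_arcs] parcs_eq_adjacency[OF G] by simp
  qed
  have sub: "component v ?E \<subseteq> pverts G"
    using component_subset_vertices undirected_edges_subset_complete_edges G v by metis
  have "sym ((adjacency ?E)\<^sup>*)"
    by (rule sym_rtrancl) (auto simp: sym_def adjacency_def insert_commute)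
  then have all: "(x, y) \<in> (adjacency ?E)\<^sup>*"
    if "x \<in> component v ?E" "y \<in> component v ?E" for x y
    using that by (auto simp: component_def dest: symD intro: rtrancl_trans)
  have "Digraph_Component.connected (with_proj G) \<longleftrightarrow>
      (\<forall>x\<in>pverts G. \<forall>y\<in>pverts G. (x, y) \<in> (adjacency ?E)\<^sup>*)"
    using v reach unfolding Digraph_Component.connected_def strongly_connected_def by auto
  also have "\<dots> \<longleftrightarrow> pverts G \<subseteq> component v ?E"
  proof
    assume "\<forall>x\<in>pverts G. \<forall>y\<in>pverts G. (x, y) \<in> (adjacency ?E)\<^sup>*"
    then show "pverts G \<subseteq> component v ?E" using v by (simp add: component_def subset_iff)
  next
    assume "pverts G \<subseteq> component v ?E"
    then show "\<forall>x\<in>pverts G. \<forall>y\<in>pverts G. (x, y) \<in> (adjacency ?E)\<^sup>*" using all by blast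
  qed
  finally show ?thesis using sub by blast
qed

theorem mainTheorem2:
  fixes n :: nat
  assumes "n \<ge> 1"
  shows "(- 1 :: int) ^ (n - 1) *
           (\<Sum>G \<in> connected_labelled_graphs n. (- 1) ^ card (undirected_edges G)) = fact (n - 1)"
proof -
  \<comment> \<open>The root is \<open>1\<close>, a vertex because \<open>n \<ge> 1\<close>.\<close>
  let ?F = "{E. E \<subseteq> complete_edges {1..n} \<and> component 1 E = {1..n}}"
  have "(\<Sum>G \<in> connected_labelled_graphs n. (- 1 :: int) ^ card (undirected_edges G)) =
      (\<Sum>E \<in> ?F. (- 1) ^ card E)"
  proof (rule sum.reindex_bij_witness
      [where i = "\<lambda>E. \<lparr>pverts = {1..n}, parcs = adjacency E\<rparr>" and j = undirected_edges])
    fix G assume G: "G \<in> connected_labelled_graphs n"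
    then show "\<lparr>pverts = {1..n}, parcs = adjacency (undirected_edges G)\<rparr> = G"
      using parcs_eq_adjacency[of G] by (simp add: connected_labelled_graphs_def)
    show "undirected_edges G \<in> ?F"
      using G assms undirected_edges_subset_complete_edges[of G] connected_iff_component[of G 1]
      by (auto simp: connected_labelled_graphs_def)
  next
    fix E assume E: "E \<in> ?F"
    then show "undirected_edges \<lparr>pverts = {1..n}, parcs = adjacency E\<rparr> = E"
      by (simp add: undirected_edges_adjacency)
    \<comment> \<open>The equation just shown turns the connectivity criterion for the rebuilt graph
      into one about \<open>E\<close>.\<close>
    then show "\<lparr>pverts = {1..n}, parcs = adjacency E\<rparr> \<in> connected_labelled_graphs n"
      using E assms pair_graph_adjacency[of "{1..n}" E]
        connected_iff_component[of "\<lparr>pverts = {1..n}, parcs = adjacency E\<rparr>" 1]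
      by (simp add: connected_labelled_graphs_def)
  qed simp
  also have "\<dots> = (- 1) ^ (n - 1) * fact (n - 1)"
    using assms by (intro signed_sum_connected) auto
  finally show ?thesis
    \<comment> \<open>The two equal signs combine to an even power of \<open>- 1\<close>.\<close>
    by (simp flip: power_add mult.assoc add: mult_2[symmetric])
qed

end
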